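(* For each integer $n \ge 5$, let $\omega^*(n)$ denote the maximum clique number $\omega(G)$ over all distance critical graphs $G$ on $n$ vertices. Then $n - \omega^*(n) = \Theta(\sqrt{n})$; that is, the maximum possible clique number of a distance critical graph on $n$ vertices is $n - \Theta(\sqrt{n})$.
   Context: All graphs are finite, simple and undirected. For vertices $x,y$ of a graph $G$, $d_G(x,y)$ is the length of a shortest path from $x$ to $y$ in $G$ ($\infty$ if none exists). A graph $G$ is distance critical if for every vertex $v \in V(G)$ there exist vertices $x,y \in V(G)\setminus\{v\}$ with $d_G(x,y) \neq d_{G-v}(x,y)$. The clique number $\omega(G)$ is the largest size of a set of pairwise adjacent vertices. (The cycle $C_n$ is distance critical for $n\ge 5$, so $\omega^*(n)$ is defined.) *)

theory Defs
  imports Complex_Main "HOL-Library.Extended_Nat" "HOL-Library.Landau_Symbols"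
begin

text \<open>A graph is given by its vertex set and its set of edges, which are two-element sets of vertices.\<close>

definition simple_graph :: "'a set \<Rightarrow> 'a set set \<Rightarrow> bool" where
  "simple_graph V E \<longleftrightarrow> finite V \<and> E \<subseteq> {e. e \<subseteq> V \<and> card e = 2}"

definition is_path :: "'a set \<Rightarrow> 'a set set \<Rightarrow> 'a list \<Rightarrow> bool" where
  "is_path V E p \<longleftrightarrow> p \<noteq> [] \<and> set p \<subseteq> V \<and> distinct p \<and> successively (\<lambda>x y. {x, y} \<in> E) p"

text \<open>The infimum over the empty set is \<open>\<infinity>\<close> in \<^typ>\<open>enat\<close>; this is the value for disconnected vertices.\<close>

definition graph_dist :: "'a set \<Rightarrow> 'a set set \<Rightarrow> 'a \<Rightarrow> 'a \<Rightarrow> enat" where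
  "graph_dist V E x y =
     (INF p \<in> {p. is_path V E p \<and> hd p = x \<and> last p = y}. enat (length p - 1))"

definition del_edges :: "'a set set \<Rightarrow> 'a \<Rightarrow> 'a set set" where
  "del_edges E v = {e \<in> E. v \<notin> e}"

definition distance_critical :: "'a set \<Rightarrow> 'a set set \<Rightarrow> bool" where
  "distance_critical V E \<longleftrightarrow>
     (\<forall>v\<in>V. \<exists>x \<in> V - {v}. \<exists>y \<in> V - {v}.
        graph_dist V E x y \<noteq> graph_dist (V - {v}) (del_edges E v) x y)"

definition is_clique :: "'a set \<Rightarrow> 'a set set \<Rightarrow> 'a set \<Rightarrow> bool" where
  "is_clique V E K \<longleftrightarrow> K \<subseteq> V \<and> (\<forall>x\<in>K. \<forall>y\<in>K. x \<noteq> y \<longrightarrow> {x, y} \<in> E)"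

definition clique_number :: "'a set \<Rightarrow> 'a set set \<Rightarrow> nat" where
  "clique_number V E = Max {card K | K. is_clique V E K}"

text \<open>Every finite graph is isomorphic to one whose vertices are natural numbers, so it suffices
  to range over these. \<^const>\<open>Max\<close> is meaningful only when a distance critical graph on \<open>n\<close>
  vertices exists, in particular for \<open>n \<ge> 5\<close> (cycles).\<close>

definition omega_star :: "nat \<Rightarrow> nat" where
  "omega_star n = Max {clique_number V E | (V :: nat set) E.
     simple_graph V E \<and> card V = n \<and> distance_critical V E}"

end

theory Submission
  imports Defs
begin

text \<open>A graph is distance critical iff every vertex \<open>v\<close> is the only common neighbour of some
  nonadjacent pair. If \<open>K\<close> is a clique with \<open>m\<close> vertices outside it, the pair of \<open>v \<in> K\<close> is not
  contained in \<open>K\<close>. If it lies outside \<open>K\<close>, it determines \<open>v\<close>; otherwise its outer vertex has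
  \<open>v\<close> as its only neighbour in \<open>K\<close>, so that this vertex determines \<open>v\<close>.
  Hence \<open>|K| \<le> m\<^sup>2\<close>. Conversely, let two cliques \<open>K\<close> and \<open>P\<close> and an independent set \<open>O\<close> with
  \<open>|O| = |P| = 2 s\<close> be given, let \<open>O\<close> be matched to \<open>P\<close>, and join the vertices of \<open>K\<close> to
  distinct pairs of vertices of \<open>O\<close> covering \<open>O\<close>. This graph is distance critical, and \<open>|K|\<close> can
  be any number between \<open>s\<close> and \<open>s\<^sup>2\<close>.\<close>

section \<open>Distance criticality as a condition on common neighbours\<close>

definition sole_common_neighbour :: "'a set \<Rightarrow> 'a set set \<Rightarrow> 'a \<Rightarrow> 'a \<Rightarrow> 'a \<Rightarrow> bool" where
  "sole_common_neighbour V E v x y \<longleftrightarrow>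
     x \<noteq> y \<and> {x, y} \<notin> E \<and> {x, v} \<in> E \<and> {v, y} \<in> E \<and>
     (\<forall>w\<in>V. {x, w} \<in> E \<longrightarrow> {w, y} \<in> E \<longrightarrow> w = v)"

lemma graph_dist_le:
  assumes "is_path V E p"
  shows "graph_dist V E (hd p) (last p) \<le> enat (length p - 1)"
  unfolding graph_dist_def using assms by (intro INF_lower) auto

lemma graph_dist_eq_path:
  assumes "graph_dist V E x y \<noteq> \<infinity>"
  obtains p where "is_path V E p" "hd p = x" "last p = y"
    "graph_dist V E x y = enat (length p - 1)"
proof -
  let ?A = "(\<lambda>p. enat (length p - 1)) ` {p. is_path V E p \<and> hd p = x \<and> last p = y}"
  have "?A \<noteq> {}"
    using assms unfolding graph_dist_def by (metis Inf_enat_def)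
  then have "Inf ?A \<in> ?A"
    unfolding Inf_enat_def by (auto intro: LeastI)
  then show thesis
    using that unfolding graph_dist_def by auto
qed

lemma is_path_delete_iff:
  "is_path (V - {v}) (del_edges E v) p \<longleftrightarrow> is_path V E p \<and> v \<notin> set p"
proof -
  have "successively (\<lambda>x y. {x, y} \<in> del_edges E v) p \<longleftrightarrow> successively (\<lambda>x y. {x, y} \<in> E) p"
    if "v \<notin> set p"
    using that by (intro successively_cong) (auto simp: del_edges_def)
  then show ?thesis
    unfolding is_path_def by blast
qed

text \<open>A shortest path from \<open>x\<close> to \<open>y\<close> must run through
  \<open>v\<close>. The vertices \<open>a\<close> and \<open>b\<close> next to \<open>v\<close> on
  it form the required pair, since an edge between them or another common neighbour would give a
  path that avoids \<open>v\<close> and is no longer.\<close>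

lemma sole_common_neighbour_if_dist_changes:
  assumes x: "x \<in> V - {v}" and y: "y \<in> V - {v}"
    and neq: "graph_dist V E x y \<noteq> graph_dist (V - {v}) (del_edges E v) x y"
  shows "\<exists>a\<in>V - {v}. \<exists>b\<in>V - {v}. sole_common_neighbour V E v a b"
proof -
  let ?d = "graph_dist V E x y" and ?d' = "graph_dist (V - {v}) (del_edges E v) x y"
  have "?d \<le> ?d'"
    unfolding graph_dist_def by (intro INF_superset_mono) (auto simp: is_path_delete_iff)
  with neq have less: "?d < ?d'" by simp
  then have "?d \<noteq> \<infinity>" by (metis enat_ord_simps(6))
  then obtain p where p: "is_path V E p" "hd p = x" "last p = y" "?d = enat (length p - 1)"
    by (rule graph_dist_eq_path)
  have no_detour: False
    if "is_path V E q" "v \<notin> set q" "hd q = x" "last q = y" "length q \<le> length p" for q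
  proof -
    have "?d' \<le> enat (length q - 1)"
      using graph_dist_le[of "V - {v}" "del_edges E v" q] that by (simp add: is_path_delete_iff)
    also have "\<dots> \<le> ?d"
      using that(5) p(4) by simp
    finally show False using less by simp
  qed
  have "v \<in> set p"
    using no_detour[of p] p by blast
  then obtain xs ys where split: "p = xs @ v # ys"
    by (auto simp: in_set_conv_decomp)
  have ne: "xs \<noteq> []" "ys \<noteq> []"
    using split p(2,3) x y by auto
  define a b where "a = last xs" and "b = hd ys"
  have path: "set xs \<subseteq> V - {v}" "set ys \<subseteq> V - {v}" "distinct (xs @ ys)"
    and edges: "{a, v} \<in> E" "{v, b} \<in> E"
    and walks: "successively (\<lambda>x y. {x, y} \<in> E) xs" "successively (\<lambda>x y. {x, y} \<in> E) ys"
    using p(1) ne unfolding is_path_def split a_def b_def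
    by (auto simp: successively_append_iff successively_Cons)
  have ends: "hd xs = x" "last ys = y"
    using p(2,3) ne unfolding split by auto
  have ab: "a \<in> set xs" "b \<in> set ys"
    using ne by (auto simp: a_def b_def)
  have "{a, b} \<notin> E"
  proof
    assume "{a, b} \<in> E"
    then have "is_path V E (xs @ ys)"
      using path walks ne unfolding is_path_def a_def b_def
      by (auto simp: successively_append_iff)
    then show False
      using no_detour[of "xs @ ys"] path ends ne by (auto simp: split)
  qed
  moreover have "w = v" if w: "w \<in> V" "{a, w} \<in> E" "{w, b} \<in> E" for w
  proof (rule ccontr)
    assume "w \<noteq> v"
    \<comment> \<open>Paths are distinct lists, so \<open>w\<close> cannot simply replace
      \<open>v\<close> if it already lies on the path. Then the path is shortened instead, going
      from \<open>w\<close> straight to \<open>b\<close> or from \<open>a\<close> straight to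
      \<open>w\<close>.\<close>
    consider (left) us us' where "xs = us @ w # us'"
      | (right) us us' where "ys = us @ w # us'"
      | (new) "w \<notin> set xs" "w \<notin> set ys"
      by (metis in_set_conv_decomp)
    then show False
    proof cases
      case left
      have "is_path V E (us @ w # ys)"
        using path walks ne w unfolding is_path_def left b_def
        by (auto simp: successively_append_iff successively_Cons)
      then show ?thesis
        using no_detour[of "us @ w # ys"] path ends ne \<open>w \<noteq> v\<close>
        by (auto simp: split left hd_append split: if_splits)
    next
      case right
      have "is_path V E (xs @ w # us')"
        using path walks ne w unfolding is_path_def right a_def
        by (auto simp: successively_append_iff successively_Cons)
      then show ?thesis
        using no_detour[of "xs @ w # us'"] path ends ne \<open>w \<noteq> v\<close>
        by (auto simp: split right)
    next
      case new
      have "is_path V E (xs @ w # ys)"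
        using path walks ne w new unfolding is_path_def a_def b_def
        by (auto simp: successively_append_iff successively_Cons)
      then show ?thesis
        using no_detour[of "xs @ w # ys"] path ends ne \<open>w \<noteq> v\<close>
        by (auto simp: split)
    qed
  qed
  ultimately show ?thesis
    unfolding sole_common_neighbour_def using path edges ab
    by (intro bexI[of _ a] bexI[of _ b]) auto
qed

lemma dist_changes_if_sole_common_neighbour:
  assumes "v \<in> V" "x \<in> V - {v}" "y \<in> V - {v}" and scn: "sole_common_neighbour V E v x y"
  shows "graph_dist V E x y \<noteq> graph_dist (V - {v}) (del_edges E v) x y"
proof -
  have xy: "x \<noteq> y" "{x, y} \<notin> E" and v: "{x, v} \<in> E" "{v, y} \<in> E"
    and sole: "\<And>w. w \<in> V \<Longrightarrow> {x, w} \<in> E \<Longrightarrow> {w, y} \<in> E \<Longrightarrow> w = v"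
    using scn unfolding sole_common_neighbour_def by blast+
  have "is_path V E [x, v, y]"
    using assms(1-3) xy v by (auto simp: is_path_def)
  from graph_dist_le[OF this] have "graph_dist V E x y \<le> enat 2"
    by (simp add: numeral_2_eq_2)
  moreover have "enat 3 \<le> graph_dist (V - {v}) (del_edges E v) x y"
    unfolding graph_dist_def
  proof (intro INF_greatest)
    fix p assume "p \<in> {p. is_path (V - {v}) (del_edges E v) p \<and> hd p = x \<and> last p = y}"
    then have p: "is_path V E p" "v \<notin> set p" "hd p = x" "last p = y"
      by (simp_all add: is_path_delete_iff)
    \<comment> \<open>\<open>length\<close> counts vertices, so a path with at most two edges is a
      list of at most three.\<close>
    have "\<not> length p \<le> 3"
    proof
      assume "length p \<le> 3"
      then have "length p = 0 \<or> length p = 1 \<or> length p = 2 \<or> length p = 3" by linarith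
      then consider "p = []" | "p = [x]" "x = y" | "p = [x, y]" | w where "p = [x, w, y]"
        using p(3,4) by (auto simp: numeral_eq_Suc length_Suc_conv)
      then show False
      proof cases
        case 4
        then show False
          using p(1,2) sole[of w] by (simp add: is_path_def)
      qed (use p(1) xy in \<open>simp_all add: is_path_def\<close>)
    qed
    then show "enat 3 \<le> enat (length p - 1)"
      by simp
  qed
  moreover have "enat 2 < enat 3" by simp
  ultimately show ?thesis by (metis leD order.trans)
qed

lemma distance_critical_iff:
  "distance_critical V E \<longleftrightarrow>
     (\<forall>v\<in>V. \<exists>x\<in>V - {v}. \<exists>y\<in>V - {v}. sole_common_neighbour V E v x y)"
  unfolding distance_critical_def
  using sole_common_neighbour_if_dist_changes dist_changes_if_sole_common_neighbour by meson

section \<open>Upper bound on cliques of critical graphs\<close>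

lemma clique_le_outside_squared:
  assumes "finite V" and crit: "distance_critical V E" and K: "is_clique V E K"
  shows "card K \<le> (card (V - K))\<^sup>2"
proof -
  let ?O = "V - K"
  have KV: "K \<subseteq> V" and adj: "\<And>x y. x \<in> K \<Longrightarrow> y \<in> K \<Longrightarrow> x \<noteq> y \<Longrightarrow> {x, y} \<in> E"
    using K unfolding is_clique_def by auto
  \<comment> \<open>Pairs outside \<open>K\<close> have distinct ends and leave the diagonal of
    \<open>?O \<times> ?O\<close> free. The diagonal encodes the mixed pairs by their outer vertex,
    so no term beyond the square arises.\<close>
  define D where "D v z \<longleftrightarrow> fst z \<in> ?O \<and> snd z \<in> ?O \<and>
    (if fst z = snd z then {v, snd z} \<in> E \<and> (\<forall>w\<in>K. {w, snd z} \<in> E \<longrightarrow> w = v)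
     else sole_common_neighbour V E v (fst z) (snd z))" for v z
  have mixed: "D v (y, y)"
    if "v \<in> K" "x \<in> K" "y \<in> ?O" and scn: "sole_common_neighbour V E v x y" for v x y
  proof -
    \<comment> \<open>Since \<open>x\<close> is adjacent to all other vertices of \<open>K\<close>
      but not to \<open>y\<close>, a neighbour of \<open>y\<close> in \<open>K\<close> is a common
      neighbour of \<open>x\<close> and \<open>y\<close>.\<close>
    have "w = v" if "w \<in> K" "{w, y} \<in> E" for w
      using scn that \<open>x \<in> K\<close> adj[of x w] KV unfolding sole_common_neighbour_def by blast
    moreover have "{v, y} \<in> E"
      using scn by (simp add: sole_common_neighbour_def)
    ultimately show ?thesis
      using \<open>y \<in> ?O\<close> by (simp add: D_def)
  qed
  have ex: "\<exists>z. D v z" if "v \<in> K" for v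
  proof -
    obtain x y where xy: "x \<in> V" "y \<in> V" "sole_common_neighbour V E v x y"
      using crit \<open>v \<in> K\<close> KV unfolding distance_critical_iff by blast
    then have yx: "sole_common_neighbour V E v y x"
      unfolding sole_common_neighbour_def by (metis insert_commute)
    have "\<not> (x \<in> K \<and> y \<in> K)"
      using xy adj unfolding sole_common_neighbour_def by blast
    then consider "x \<in> K" "y \<in> ?O" | "y \<in> K" "x \<in> ?O" | "x \<in> ?O" "y \<in> ?O"
      using xy by blast
    then show ?thesis
    proof cases
      case 3
      then have "D v (x, y)"
        using xy by (simp add: D_def sole_common_neighbour_def)
      then show ?thesis ..
    qed (use mixed that xy yx in blast)+
  qed
  then obtain g where g: "\<And>v. v \<in> K \<Longrightarrow> D v (g v)"
    by metis
  have "u = v" if "u \<in> K" "v \<in> K" "D u z" "D v z" for u v z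
  proof (cases "fst z = snd z")
    case True
    then have "{u, snd z} \<in> E" "\<And>w. w \<in> K \<Longrightarrow> {w, snd z} \<in> E \<Longrightarrow> w = v"
      using that(3,4) by (simp_all add: D_def)
    then show ?thesis using that(1) by metis
  next
    case False
    then have "sole_common_neighbour V E u (fst z) (snd z)" "sole_common_neighbour V E v (fst z) (snd z)"
      using that by (simp_all add: D_def)
    then have "{fst z, u} \<in> E" "{u, snd z} \<in> E"
      "\<And>w. w \<in> V \<Longrightarrow> {fst z, w} \<in> E \<Longrightarrow> {w, snd z} \<in> E \<Longrightarrow> w = v"
      by (simp_all add: sole_common_neighbour_def)
    then show ?thesis using that(1) KV by (metis subsetD)
  qed
  then have "inj_on g K"
    using g by (intro inj_onI) metis
  moreover have "g ` K \<subseteq> ?O \<times> ?O"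
  proof (intro image_subsetI)
    fix v assume "v \<in> K"
    from g[OF this] show "g v \<in> ?O \<times> ?O"
      unfolding D_def mem_Times_iff by blast
  qed
  ultimately have "card K \<le> card (?O \<times> ?O)"
    using \<open>finite V\<close> by (intro card_inj_on_le) auto
  then show ?thesis
    by (simp add: card_cartesian_product power2_eq_square)
qed

section \<open>The maxima defining \<open>clique_number\<close> and
  \<open>omega_star\<close>\<close>

lemma finite_clique_sizes: "finite V \<Longrightarrow> finite {card K | K. is_clique V E K}"
  by (rule finite_subset[of _ "{..card V}"]) (auto simp: is_clique_def card_mono)

lemma card_clique_le_clique_number:
  assumes "finite V" "is_clique V E K"
  shows "card K \<le> clique_number V E"
  unfolding clique_number_def using assms finite_clique_sizes[OF assms(1)] by (intro Max_ge) auto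

lemma clique_number_attained:
  assumes "finite V"
  obtains K where "is_clique V E K" "clique_number V E = card K"
proof -
  have "is_clique V E {}" by (simp add: is_clique_def)
  then have "{card K | K. is_clique V E K} \<noteq> {}" by blast
  from Max_in[OF finite_clique_sizes[OF assms] this] show thesis
    using that unfolding clique_number_def by auto
qed

lemma clique_number_le_card: "finite V \<Longrightarrow> clique_number V E \<le> card V"
  by (metis clique_number_attained is_clique_def card_mono)

text \<open>There may be infinitely many such graphs on natural numbers, but their clique numbers
  are at most \<open>n\<close>.\<close>

lemma finite_critical_clique_numbers:
  "finite {clique_number V E | (V :: nat set) E.
     simple_graph V E \<and> card V = n \<and> distance_critical V E}"
  by (rule finite_subset[of _ "{..n}"]) (auto simp: simple_graph_def clique_number_le_card)

lemma clique_le_omega_star: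
  fixes V :: "nat set"
  assumes "simple_graph V E" "card V = n" "distance_critical V E" "is_clique V E K"
  shows "card K \<le> omega_star n"
proof -
  have "card K \<le> clique_number V E"
    using assms by (intro card_clique_le_clique_number) (auto simp: simple_graph_def)
  also have "\<dots> \<le> omega_star n"
    unfolding omega_star_def using assms by (intro Max_ge finite_critical_clique_numbers) auto
  finally show ?thesis .
qed

lemma omega_star_attained:
  fixes V\<^sub>0 :: "nat set"
  assumes "simple_graph V\<^sub>0 E\<^sub>0" "card V\<^sub>0 = n" "distance_critical V\<^sub>0 E\<^sub>0"
  obtains V :: "nat set" and E K where "simple_graph V E" "card V = n" "distance_critical V E"
    "is_clique V E K" "omega_star n = card K"
proof -
  have "omega_star n \<in> {clique_number V E | (V :: nat set) E.
     simple_graph V E \<and> card V = n \<and> distance_critical V E}"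
    unfolding omega_star_def using assms by (intro Max_in finite_critical_clique_numbers) auto
  then obtain V :: "nat set" and E where G: "simple_graph V E" "card V = n" "distance_critical V E"
    and eq: "omega_star n = clique_number V E"
    by auto
  moreover from G(1) obtain K where "is_clique V E K" "clique_number V E = card K"
    by (meson simple_graph_def clique_number_attained)
  ultimately show thesis
    using that by metis
qed

section \<open>Critical graphs with large cliques\<close>

definition edges_of :: "'a set \<Rightarrow> ('a \<Rightarrow> 'a \<Rightarrow> bool) \<Rightarrow> 'a set set" where
  "edges_of V R = {{x, y} | x y. x \<in> V \<and> y \<in> V \<and> x \<noteq> y \<and> R x y}"

lemma simple_graph_edges_of: "finite V \<Longrightarrow> simple_graph V (edges_of V R)"
  by (auto simp: simple_graph_def edges_of_def)

lemma edge_edges_of_iff: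
  assumes "symp R"
  shows "{x, y} \<in> edges_of V R \<longleftrightarrow> x \<in> V \<and> y \<in> V \<and> x \<noteq> y \<and> R x y"
  using assms unfolding edges_of_def by (auto simp: doubleton_eq_iff dest: sympD)

lemma critical_graph_exists:
  fixes s N :: nat
  assumes "0 < s" "s \<le> N" "N \<le> s\<^sup>2"
  obtains V :: "nat set" and E K where "simple_graph V E" "card V = 4 * s + N"
    "distance_critical V E" "is_clique V E K" "card K = N"
proof -
  \<comment> \<open>The pair for \<open>t\<close>; those for \<open>t < s\<close> form a perfect matching of \<open>{..<2 * s}\<close>, whence
    \<open>s \<le> N\<close> suffices for covering.\<close>
  define f g where "f t = t mod s" and "g t = s + (t mod s + t div s) mod s" for t
  \<comment> \<open>In base \<open>s\<close>, \<open>f t\<close> is the last digit of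
    \<open>t\<close>, and \<open>g t\<close> shifts it cyclically by the leading digit. As
    \<open>t < s\<^sup>2\<close>, the leading digit is below \<open>s\<close> and can be
    recovered.\<close>
  have inj: "t = u" if "f t = f u" "g t = g u" "t < N" "u < N" for t u
  proof -
    have "t div s < s" "u div s < s"
      using that assms by (auto simp: power2_eq_square less_mult_imp_div_less)
    moreover have "(t mod s + t div s) mod s = (t mod s + u div s) mod s"
      using that by (simp add: f_def g_def)
    \<comment> \<open>Adding \<open>s - t mod s\<close> cancels the last digit without leaving the
      natural numbers.\<close>
    from mod_add_cong[OF refl this]
    have "(s - t mod s + (t mod s + t div s)) mod s = (s - t mod s + (t mod s + u div s)) mod s" .
    moreover have "t mod s \<le> s"
      using assms(1) by (simp add: less_imp_le)
    ultimately have "t div s = u div s"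
      by (simp flip: add.assoc)
    then show ?thesis
      using that(1) unfolding f_def by (metis div_mod_decomp)
  qed
  have fg: "f t < s" "s \<le> g t" "g t < 2 * s" for t
    using assms by (auto simp: f_def g_def)
  have cover: "\<exists>t<N. f t = i \<or> g t = i" if "i < 2 * s" for i
  proof (cases "i < s")
    case True
    then show ?thesis using assms by (intro exI[of _ i]) (auto simp: f_def)
  next
    case False
    then show ?thesis
      using assms that by (intro exI[of _ "i - s"]) (auto simp: g_def)
  qed
  \<comment> \<open>\<open>O\<close>, \<open>P\<close> and \<open>K\<close> occupy \<open>[0, 2s)\<close>, \<open>[2s, 4s)\<close> and \<open>[4s, 4s + N)\<close>.\<close>
  define V where "V = {..<4 * s + N}"
  define R where "R x y \<longleftrightarrow> 4 * s \<le> x \<and> 4 * s \<le> y \<or> x \<in> {2 * s..<4 * s} \<and> y \<in> {2 * s..<4 * s} \<or>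
    x < 2 * s \<and> (y = x + 2 * s \<or> 4 * s \<le> y \<and> x \<in> {f (y - 4 * s), g (y - 4 * s)})" for x y
  define E where "E = edges_of V (\<lambda>x y. R x y \<or> R y x)"
  have E: "{x, y} \<in> E \<longleftrightarrow> x \<in> V \<and> y \<in> V \<and> x \<noteq> y \<and> (R x y \<or> R y x)" for x y
    unfolding E_def by (intro edge_edges_of_iff) (auto intro: sympI)
  have "\<exists>x\<in>V - {v}. \<exists>y\<in>V - {v}. sole_common_neighbour V E v x y" if "v \<in> V" for v
  proof -
    consider "v < 2 * s" | i where "v = 2 * s + i" "i < 2 * s" | t where "v = 4 * s + t" "t < N"
    proof -
      have "v < 2 * s \<or> v = 2 * s + (v - 2 * s) \<and> v - 2 * s < 2 * s \<or>
          v = 4 * s + (v - 4 * s) \<and> v - 4 * s < N"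
        using \<open>v \<in> V\<close> unfolding V_def by auto
      then show thesis using that by blast
    qed
    then show ?thesis
    proof cases
      case 1
      then obtain t where t: "t < N" "f t = v \<or> g t = v"
        using cover by blast
      \<comment> \<open>There are no edges between P and K, and the only neighbour of
        \<open>2 * s + v\<close> outside P is \<open>v\<close>.\<close>
      have "sole_common_neighbour V E v (2 * s + v) (4 * s + t)"
        unfolding sole_common_neighbour_def E using 1 t by (auto simp: V_def R_def)
      then show ?thesis
        using 1 t by (intro bexI[of _ "2 * s + v"] bexI[of _ "4 * s + t"]) (auto simp: V_def)
    next
      case (2 i)
      obtain j where j: "j < 2 * s" "j \<noteq> i"
        using \<open>0 < s\<close> by (cases "i = 0") (auto intro: that[of 0] that[of 1])
      \<comment> \<open>The only neighbour of \<open>i\<close> in P is \<open>v\<close>, and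
        \<open>2 * s + j\<close> has no neighbour in K.\<close>
      have "sole_common_neighbour V E v i (2 * s + j)"
        unfolding sole_common_neighbour_def E using 2 j by (auto simp: V_def R_def)
      then show ?thesis
        using 2 j by (intro bexI[of _ i] bexI[of _ "2 * s + j"]) (auto simp: V_def)
    next
      case (3 t)
      \<comment> \<open>O is independent and the two vertices have different partners in P, so
        \<open>w\<close> lies in K. Values of \<open>f\<close> are below \<open>s\<close> and those
        of \<open>g\<close> are not, so the pairs of \<open>w\<close> and \<open>v\<close> agree in
        order.\<close>
      have "w = v" if "w \<in> V" "{f t, w} \<in> E" "{w, g t} \<in> E" for w
      proof -
        have "4 * s \<le> w" "f t \<in> {f (w - 4 * s), g (w - 4 * s)}" "g t \<in> {f (w - 4 * s), g (w - 4 * s)}"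
          using that fg[of t] unfolding E R_def by auto
        moreover from this have "f t = f (w - 4 * s)" "g t = g (w - 4 * s)"
          using fg[of t] fg[of "w - 4 * s"] by auto
        ultimately show ?thesis
          using inj[of t "w - 4 * s"] 3 \<open>w \<in> V\<close> by (auto simp: V_def)
      qed
      then have "sole_common_neighbour V E v (f t) (g t)"
        unfolding sole_common_neighbour_def unfolding E using 3 fg[of t] by (auto simp: V_def R_def)
      then show ?thesis
        using 3 fg[of t] by (intro bexI[of _ "f t"] bexI[of _ "g t"]) (auto simp: V_def)
    qed
  qed
  then have "distance_critical V E"
    unfolding distance_critical_iff by blast
  moreover have "is_clique V E {4 * s..<4 * s + N}"
    unfolding is_clique_def E by (auto simp: V_def R_def)
  ultimately show thesis
    using that[of V E "{4 * s..<4 * s + N}"] by (auto simp: V_def E_def simple_graph_edges_of)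
qed

section \<open>Bounds on \<open>omega_star\<close> and the asymptotics\<close>

lemma omega_star_upper_bound:
  fixes V :: "nat set"
  assumes crit: "simple_graph V E" "card V = n" "distance_critical V E"
  shows "omega_star n \<le> n" "n \<le> 2 * (n - omega_star n)\<^sup>2"
proof -
  obtain V :: "nat set" and E K where G: "simple_graph V E" "card V = n" "distance_critical V E"
    "is_clique V E K" and K: "omega_star n = card K"
    using omega_star_attained[OF crit] .
  have fin: "finite V" and "K \<subseteq> V"
    using G by (auto simp: simple_graph_def is_clique_def)
  then show "omega_star n \<le> n"
    using G K by (auto simp: card_mono)
  have m: "card (V - K) = n - omega_star n"
    using G K \<open>K \<subseteq> V\<close> fin by (simp add: card_Diff_subset finite_subset)
  then have "omega_star n \<le> (n - omega_star n)\<^sup>2"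
    using clique_le_outside_squared[OF fin G(3,4)] K by simp
  \<comment> \<open>For \<open>m = n - omega_star n\<close> this gives
    \<open>n \<le> m\<^sup>2 + m \<le> 2 * m\<^sup>2\<close>.\<close>
  moreover have "n - omega_star n \<le> (n - omega_star n)\<^sup>2"
    by (simp only: power2_eq_square le_square)
  ultimately show "n \<le> 2 * (n - omega_star n)\<^sup>2"
    by linarith
qed

text \<open>The construction is used with \<open>s\<close> the ceiling of the square root of
  \<open>n\<close> and \<open>N = n - 4 * s\<close>. The bound 36 ensures \<open>s \<le> N\<close>,
  as then \<open>5 * s \<le> 6 * sqrt n \<le> n\<close>.\<close>

lemma omega_star_bounds:
  assumes "36 \<le> n"
  shows "omega_star n \<le> n" "n \<le> 2 * (n - omega_star n)\<^sup>2"
    "real n - real (omega_star n) \<le> 4 * sqrt (real n) + 4"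
proof -
  define s where "s = nat \<lceil>sqrt (real n)\<rceil>"
  have s: "sqrt (real n) \<le> real s" "real s \<le> sqrt (real n) + 1"
    unfolding s_def using of_int_ceiling_le_add_one[of "sqrt (real n)"] by (simp_all add: of_nat_nat)
  have "6 \<le> sqrt (real n)"
    using assms by (intro real_le_rsqrt) auto
  then have "0 < s"
    using s by (cases s) auto
  have "real n \<le> (real s)\<^sup>2"
    using s(1) by (rule sqrt_le_D)
  then have "n \<le> s\<^sup>2"
    by (metis of_nat_le_iff of_nat_power)
  have "5 * s \<le> n"
  proof -
    have "5 * real s \<le> 6 * sqrt (real n)"
      using s(2) \<open>6 \<le> sqrt (real n)\<close> by linarith
    also have "\<dots> \<le> sqrt (real n) * sqrt (real n)"
      using \<open>6 \<le> sqrt (real n)\<close> by (intro mult_right_mono) auto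
    finally show ?thesis by simp
  qed
  then have "s \<le> n - 4 * s" "n - 4 * s \<le> s\<^sup>2" and n: "4 * s + (n - 4 * s) = n"
    using \<open>n \<le> s\<^sup>2\<close> by linarith+
  from critical_graph_exists[OF \<open>0 < s\<close> this(1,2)]
  obtain V :: "nat set" and E K where G: "simple_graph V E" "card V = n"
    "distance_critical V E" "is_clique V E K" "card K = n - 4 * s"
    unfolding n .
  show "omega_star n \<le> n" "n \<le> 2 * (n - omega_star n)\<^sup>2"
    using omega_star_upper_bound[OF G(1,2,3)] .
  have "n - 4 * s \<le> omega_star n"
    using clique_le_omega_star[OF G(1,2,3,4)] G(5) by simp
  then show "real n - real (omega_star n) \<le> 4 * sqrt (real n) + 4"
    using s(2) by linarith
qed

theorem theorem5p8:
  "(\<lambda>n::nat. real n - real (omega_star n)) \<in> \<Theta>(\<lambda>n. sqrt (real n))"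
proof (rule bigthetaI)
  show "(\<lambda>n. real n - real (omega_star n)) \<in> O(\<lambda>n. sqrt (real n))"
  \<comment> \<open>The constant is 4 + 4, the additive 4 being absorbed because
    \<open>sqrt n\<close> is at least 1.\<close>
  proof (rule bigoI[of _ 8], rule eventually_mono[OF eventually_ge_at_top[of 36]])
    fix n :: nat assume "36 \<le> n"
    then have "1 \<le> sqrt (real n)" by simp
    moreover have "omega_star n \<le> n" "real n - real (omega_star n) \<le> 4 * sqrt (real n) + 4"
      using omega_star_bounds[of n] \<open>36 \<le> n\<close> by simp_all
    ultimately have "real n - real (omega_star n) \<le> 8 * sqrt (real n)"
      by linarith
    with \<open>omega_star n \<le> n\<close>
    show "norm (real n - real (omega_star n)) \<le> 8 * norm (sqrt (real n))"
      by simp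
  qed
  show "(\<lambda>n. real n - real (omega_star n)) \<in> \<Omega>(\<lambda>n. sqrt (real n))"
    unfolding bigomega_iff_bigo
  proof (rule bigoI[of _ "sqrt 2"], rule eventually_mono[OF eventually_ge_at_top[of 36]])
    fix n :: nat assume "36 \<le> n"
    define m where "m = n - omega_star n"
    have "omega_star n \<le> n" "n \<le> 2 * m\<^sup>2"
      using omega_star_bounds[of n] \<open>36 \<le> n\<close> by (simp_all add: m_def)
    then have "sqrt (real n) \<le> sqrt (2 * (real m)\<^sup>2)"
      by (metis real_sqrt_le_iff of_nat_le_iff of_nat_mult of_nat_numeral of_nat_power)
    then have "sqrt (real n) \<le> sqrt 2 * real m"
      by (simp add: real_sqrt_mult)
    then show "norm (sqrt (real n)) \<le> sqrt 2 * norm (real n - real (omega_star n))"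
      using \<open>omega_star n \<le> n\<close> by (simp add: m_def of_nat_diff)
  qed
qed

end
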